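(* Let $\Sigma=(\Sigma_t)_{t\ge 0}$ be an abstract linear control system with state space $Y$, control space $U$ (Banach spaces) and exponent $p\in[1,\infty]$. Assume that there exist a family $(P_k)_{k\in\mathbb{N}}$ of projections on $Y$ and constants $C_1,C_2,c_1,c_2,a,b,m>0$ with $a<b$ such that, for all $k\in\mathbb{N}$: (i) for all $T\in(0,1]$ and $y_0\in Y$, there exists $u\in L^p(\mathbb{R}_+;U)$ such that $P_k\Sigma_T(y_0,u)=0$ and $\|u\|_{L^p}\le C_1 e^{c_1k^a}\|y_0\|_Y$; (ii) for all $T\in(0,1]$ and $y_0\in Y$, if $P_ky_0=0$ then $\|\Sigma_T(y_0,0)\|_Y\le C_2e^{-c_2T^mk^b}\|y_0\|_Y$. Then $\Sigma$ is small-time null-controllable. More precisely, there exist constants $C_0,c_0>0$ such that, for every $T\in(0,1]$ and $y_0\in Y$, there exists $u\in L^p((0,T);U)$ such that $\Sigma_T(y_0,u)=0$ and $$\|u\|_{L^p}\le C_0\exp\left(c_0T^{-\sigma}\right)\|y_0\|_Y\qquad\text{where}\qquad \sigma:=\frac{am}{b-a}.$$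
   Context: $\mathbb{N}=\{0,1,2,\dots\}$. For $u,v\in L^p(\mathbb{R}_+;U)$ and $\tau\ge0$, the $\tau$-concatenation $u\diamond_\tau v\in L^p(\mathbb{R}_+;U)$ is defined by $(u\diamond_\tau v)(s)=u(s)$ for $s\in[0,\tau)$ and $(u\diamond_\tau v)(s)=v(s-\tau)$ for $s\ge\tau$. An abstract linear control system is a family $(\Sigma_t)_{t\ge0}$ of continuous linear maps from $Y\times L^p(\mathbb{R}_+;U)$ to $Y$ such that: for all $y_0\in Y$ and $u\in L^p(\mathbb{R}_+;U)$, $t\mapsto\Sigma_t(y_0,u)$ is continuous on $\mathbb{R}_+$ with $\Sigma_0(y_0,u)=y_0$; and for all $t,\tau\ge0$, $y_0\in Y$, $u,v\in L^p(\mathbb{R}_+;U)$, $\Sigma_{t+\tau}(y_0,u\diamond_\tau v)=\Sigma_t(\Sigma_\tau(y_0,u),v)$. By the last property $\Sigma_T(y_0,u)$ depends only on $u|_{(0,T)}$, so $\Sigma_T(y_0,u)$ makes sense for $u\in L^p((0,T);U)$ (extend $u$ by $0$). A projection on $Y$ is a bounded linear map $P:Y\to Y$ with $P^2=P$. Small-time null-controllable means that for every $T>0$ and $y_0\in Y$ there is $u\in L^p((0,T);U)$ with $\Sigma_T(y_0,u)=0$. *)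

theory Defs
  imports "HOL-Analysis.Analysis" "HOL-Probability.Essential_Supremum"
begin

text \<open>
  Banach spaces are real and need not be separable, so that the right notion of
  measurability for vector-valued functions is strong (Bochner) measurability:
  almost everywhere limit of simple functions.  For nonseparable spaces it is stronger
  than Borel measurability.
\<close>

definition strongly_measurable :: "'a measure \<Rightarrow> ('a \<Rightarrow> 'u::real_normed_vector) \<Rightarrow> bool" where
  "strongly_measurable M f \<longleftrightarrow>
     (\<exists>s. (\<forall>n::nat. simple_function M (s n)) \<and> (AE x in M. (\<lambda>n. s n x) \<longlonglongrightarrow> f x))"

text \<open>
  The set \<open>Lp p M\<close> consists of representatives; elements of the usual Lebesgue space are the
  classes of its elements modulo equality almost everywhere.  The exponent ranges over \<open>[1, \<infinity>]\<close>
  (the lower bound is imposed where the space is used).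
\<close>

definition Lp :: "ennreal \<Rightarrow> 'a measure \<Rightarrow> ('a \<Rightarrow> 'u::real_normed_vector) set" where
  "Lp p M = {u. strongly_measurable M u \<and>
     (if p = \<infinity> then esssup M (\<lambda>x. ennreal (norm (u x))) < \<infinity>
      else (\<integral>\<^sup>+x. ennreal (norm (u x) powr enn2real p) \<partial>M) < \<infinity>)}"

definition Lp_norm :: "ennreal \<Rightarrow> 'a measure \<Rightarrow> ('a \<Rightarrow> 'u::real_normed_vector) \<Rightarrow> real" where
  "Lp_norm p M u =
     (if p = \<infinity> then enn2real (esssup M (\<lambda>x. ennreal (norm (u x))))
      else enn2real (\<integral>\<^sup>+x. ennreal (norm (u x) powr enn2real p) \<partial>M) powr (1 / enn2real p))"

text \<open>
  Functions on a subset \<open>S\<close> of the real line are total functions on which only the values on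
  \<open>S\<close> matter; the measure is \<open>lebesgue_on S\<close>.
\<close>

abbreviation Rplus :: "real measure" where
  "Rplus \<equiv> lebesgue_on {0..}"

definition concatenation :: "real \<Rightarrow> (real \<Rightarrow> 'u) \<Rightarrow> (real \<Rightarrow> 'u) \<Rightarrow> real \<Rightarrow> 'u" where
  "concatenation \<tau> u v = (\<lambda>s. if s < \<tau> then u s else v (s - \<tau>))"

definition zero_extension :: "real set \<Rightarrow> (real \<Rightarrow> 'u::zero) \<Rightarrow> real \<Rightarrow> 'u" where
  "zero_extension S u = (\<lambda>s. if s \<in> S then u s else 0)"

text \<open>
  The maps \<open>\<Sigma> t\<close> act on the product of the state space and \<open>Lp p Rplus\<close>.  The assumption
  \<open>AE_cong\<close> says that they are well defined on classes; the next three say that they are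
  linear and, in the sense of \<^const>\<open>bounded_linear\<close>, continuous.  That constant itself is not
  applicable, since the Lebesgue spaces are not types.
\<close>

locale abstract_linear_control_system =
  fixes p :: ennreal
    and \<Sigma> :: "real \<Rightarrow> 'y::banach \<times> (real \<Rightarrow> 'u::banach) \<Rightarrow> 'y"
  assumes exponent: "1 \<le> p"
    and AE_cong: "\<And>t y u v. \<lbrakk>0 \<le> t; u \<in> Lp p Rplus; v \<in> Lp p Rplus; AE s in Rplus. u s = v s\<rbrakk>
      \<Longrightarrow> \<Sigma> t (y, u) = \<Sigma> t (y, v)"
    and add: "\<And>t y z u v. \<lbrakk>0 \<le> t; u \<in> Lp p Rplus; v \<in> Lp p Rplus\<rbrakk>
      \<Longrightarrow> \<Sigma> t (y + z, \<lambda>s. u s + v s) = \<Sigma> t (y, u) + \<Sigma> t (z, v)"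
    and scale: "\<And>t (c::real) y u. \<lbrakk>0 \<le> t; u \<in> Lp p Rplus\<rbrakk>
      \<Longrightarrow> \<Sigma> t (c *\<^sub>R y, \<lambda>s. c *\<^sub>R u s) = c *\<^sub>R \<Sigma> t (y, u)"
    and bounded: "\<And>t. 0 \<le> t
      \<Longrightarrow> \<exists>K. \<forall>y. \<forall>u\<in>Lp p Rplus. norm (\<Sigma> t (y, u)) \<le> K * (norm y + Lp_norm p Rplus u)"
    and continuous: "\<And>y u. u \<in> Lp p Rplus \<Longrightarrow> continuous_on {0..} (\<lambda>t. \<Sigma> t (y, u))"
    and initial: "\<And>y u. u \<in> Lp p Rplus \<Longrightarrow> \<Sigma> 0 (y, u) = y"
    and concat: "\<And>t \<tau> y u v. \<lbrakk>0 \<le> t; 0 \<le> \<tau>; u \<in> Lp p Rplus; v \<in> Lp p Rplus\<rbrakk>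
      \<Longrightarrow> \<Sigma> (t + \<tau>) (y, concatenation \<tau> u v) = \<Sigma> t (\<Sigma> \<tau> (y, u), v)"

definition is_projection :: "('y::real_normed_vector \<Rightarrow> 'y) \<Rightarrow> bool" where
  "is_projection P \<longleftrightarrow> bounded_linear P \<and> P \<circ> P = P"

definition small_time_null_controllable ::
    "ennreal \<Rightarrow> (real \<Rightarrow> 'y::banach \<times> (real \<Rightarrow> 'u::banach) \<Rightarrow> 'y) \<Rightarrow> bool" where
  "small_time_null_controllable p \<Sigma> \<longleftrightarrow>
     (\<forall>T>0. \<forall>y0. \<exists>u\<in>Lp p (lebesgue_on {0<..<T}). \<Sigma> T (y0, zero_extension {0<..<T} u) = 0)"

end

theory Submission
  imports Defs
begin

text \<open>
  The interval \<open>[0, T)\<close> is cut into consecutive pieces of lengths \<open>\<tau>\<^sub>n = T (1 - r) r\<^sup>n\<close> with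
  \<open>r = 2 powr (- (b - a) / m)\<close>.  On the first half of the \<open>n\<close>-th piece hypothesis (i) is used with
  \<open>k\<^sub>n \<approx> N 2\<^sup>n\<close>, and on the second half the system evolves freely, so that (ii) applies.
  The choice of \<open>r\<close> makes the dissipation exponent \<open>\<tau>\<^sub>n powr m * k\<^sub>n powr b\<close> and the cost exponent
  \<open>k\<^sub>n powr a\<close> grow at the same geometric rate \<open>\<rho> = 2 powr a\<close>, and the dissipation wins as soon as
  \<open>N powr (b - a) = A * T powr (- m)\<close> with \<open>A\<close> large.  The states then
  decrease like \<open>exp (\<beta> * N powr a * (1 - \<rho>\<^sup>n))\<close>, which makes the controls summable; their total cost is of
  order \<open>exp (\<beta> * N powr a)\<close>, and \<open>N powr a\<close> is a multiple of \<open>T powr (- \<sigma>)\<close>.  Continuity of the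
  trajectory at \<open>T\<close> gives the null state.
\<close>

section \<open>Lebesgue spaces\<close>

lemma strongly_measurableE:
  assumes "strongly_measurable M f"
  obtains s where "\<And>n::nat. simple_function M (s n)" "AE x in M. (\<lambda>n. s n x) \<longlonglongrightarrow> f x"
  using assms unfolding strongly_measurable_def by blast

lemma strongly_measurableI:
  assumes "\<And>n::nat. simple_function M (s n)" "AE x in M. (\<lambda>n. s n x) \<longlonglongrightarrow> f x"
  shows "strongly_measurable M f"
  using assms unfolding strongly_measurable_def by blast

text \<open>Infinitely many pieces do not fit into one simple function, so the n-th approximant
  keeps only the pieces with index at most n and is 0 elsewhere; each point is covered from the
  index \<open>j x\<close> on. The limit control of the iteration is glued in this way.\<close>

lemma strongly_measurable_glue:
  fixes F :: "nat \<Rightarrow> 'a \<Rightarrow> 'u::real_normed_vector"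
  assumes F: "\<And>i. strongly_measurable M (F i)" and j: "j \<in> measurable M (count_space UNIV)"
  shows "strongly_measurable M (\<lambda>x. F (j x) x)"
proof -
  obtain s where s: "\<And>i n. simple_function M (s i n)"
    and lim: "\<And>i. AE x in M. (\<lambda>n. s i n x) \<longlonglongrightarrow> F i x"
    using F unfolding strongly_measurable_def by metis
  define g where "g n x = (\<Sum>i\<le>n. if j x = i then s i n x else 0)" for n x
  have "{x \<in> space M. j x = i} \<in> sets M" for i
    using measurable_sets[OF j, of "{i}"] by (simp add: vimage_def Int_def conj_commute)
  then have "simple_function M (\<lambda>x. if j x = i then s i n x else 0)" for i n
    by (intro simple_function_If[OF s simple_function_const])
  then have "simple_function M (g n)" for n
    unfolding g_def by (rule simple_function_sum)
  moreover have "AE x in M. \<forall>i. (\<lambda>n. s i n x) \<longlonglongrightarrow> F i x"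
    using lim by (simp add: AE_all_countable)
  then have "AE x in M. (\<lambda>n. g n x) \<longlonglongrightarrow> F (j x) x"
  proof eventually_elim
    case (elim x)
    have "\<forall>\<^sub>F n in sequentially. s (j x) n x = g n x"
      using eventually_ge_at_top[of "j x"] by eventually_elim (simp add: g_def sum.delta')
    from tendsto_cong[OF this] show ?case using elim by blast
  qed
  ultimately show ?thesis unfolding strongly_measurable_def by blast
qed

lemma strongly_measurable_0: "strongly_measurable M (\<lambda>_. 0)"
  unfolding strongly_measurable_def by (intro exI[of _ "\<lambda>_ _. 0"]) auto

lemma simple_function_zero_extension:
  fixes h :: "real \<Rightarrow> 'u::real_normed_vector"
  assumes "S \<in> sets lebesgue"
  shows "simple_function (lebesgue_on S) h \<longleftrightarrow> simple_function lebesgue (zero_extension S h)"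
proof -
  have S: "S \<inter> space lebesgue \<in> sets lebesgue" using assms by simp
  show ?thesis
    unfolding simple_function_restrict_space[OF S]
    by (intro simple_function_cong) (auto simp: zero_extension_def)
qed

lemma strongly_measurable_zero_extension:
  fixes f :: "real \<Rightarrow> 'u::real_normed_vector"
  assumes "S \<in> sets lebesgue"
  shows "strongly_measurable (lebesgue_on S) f \<longleftrightarrow> strongly_measurable lebesgue (zero_extension S f)"
proof
  assume "strongly_measurable (lebesgue_on S) f"
  then obtain s where s: "\<And>n. simple_function (lebesgue_on S) (s n)"
    and lim: "AE x in lebesgue_on S. (\<lambda>n. s n x) \<longlonglongrightarrow> f x"
    using strongly_measurableE by metis
  show "strongly_measurable lebesgue (zero_extension S f)"
  proof (rule strongly_measurableI)
    show "simple_function lebesgue (zero_extension S (s n))" for n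
      using s simple_function_zero_extension[OF assms] by blast
    show "AE x in lebesgue. (\<lambda>n. zero_extension S (s n) x) \<longlonglongrightarrow> zero_extension S f x"
      using lim assms by (simp add: AE_restrict_space_iff) (auto simp: zero_extension_def elim!: eventually_mono)
  qed
next
  assume "strongly_measurable lebesgue (zero_extension S f)"
  then obtain s where s: "\<And>n. simple_function lebesgue (s n)"
    and lim: "AE x in lebesgue. (\<lambda>n. s n x) \<longlonglongrightarrow> zero_extension S f x"
    using strongly_measurableE by metis
  show "strongly_measurable (lebesgue_on S) f"
  proof (rule strongly_measurableI)
    show "simple_function (lebesgue_on S) (s n)" for n
      unfolding simple_function_zero_extension[OF assms] zero_extension_def
      using simple_function_If_set[OF s[of n] simple_function_const[of _ 0], of S] assms by simp
    show "AE x in lebesgue_on S. (\<lambda>n. s n x) \<longlonglongrightarrow> f x"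
      using lim assms by (simp add: AE_restrict_space_iff) (auto simp: zero_extension_def elim!: eventually_mono)
  qed
qed

lemma complete_measure_lebesgue_on:
  assumes "S \<in> sets lebesgue"
  shows "complete_measure (lebesgue_on S)"
proof
  fix A B assume *: "B \<subseteq> A" "A \<in> null_sets (lebesgue_on S)"
  then have A: "A \<subseteq> S" "A \<in> null_sets lebesgue"
    using assms by (auto simp: null_sets_restrict_space)
  then have "B \<in> null_sets lebesgue" using * null_sets_completion_subset by blast
  then show "B \<in> sets (lebesgue_on S)"
    using A * by (auto simp: sets_restrict_space)
qed

text \<open>The preimages of a Borel set under \<open>f\<close> and \<open>g\<close> differ by a
  subset of a null set, which is measurable by completeness.\<close>

lemma (in complete_measure) borel_measurable_AE_eq:
  assumes g: "g \<in> borel_measurable M" and eq: "AE x in M. f x = g x"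
  shows "f \<in> borel_measurable M"
proof (rule measurableI)
  fix A :: "'b set" assume "A \<in> sets borel"
  then have "g -` A \<inter> space M \<in> sets M" using g by (simp add: measurable_sets)
  then show "f -` A \<inter> space M \<in> sets M"
    by (rule in_sets_AE[rotated]) (use eq in \<open>auto elim!: eventually_mono\<close>)
qed simp

text \<open>The approximants converge only almost everywhere, so the norm agrees with a measurable
  \<open>lim\<close> off a null set, and completeness does the rest. Essential suprema, additivity
  of integrals and Fatou's lemma rely on this.\<close>

lemma (in complete_measure) strongly_measurable_norm:
  assumes "strongly_measurable M f"
  shows "(\<lambda>x. norm (f x)) \<in> borel_measurable M"
proof -
  obtain s where s: "\<And>n. simple_function M (s n)"
    and lim: "AE x in M. (\<lambda>n. s n x) \<longlonglongrightarrow> f x"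
    using assms unfolding strongly_measurable_def by blast
  have "(\<lambda>x. norm (s n x)) \<in> borel_measurable M" for n
    using s by (intro borel_measurable_simple_function simple_function_compose1[where g=norm])
  then have "(\<lambda>x. lim (\<lambda>n. norm (s n x))) \<in> borel_measurable M"
    by (rule borel_measurable_lim_metric)
  moreover have "AE x in M. norm (f x) = lim (\<lambda>n. norm (s n x))"
    using lim by eventually_elim (auto intro!: limI[symmetric] tendsto_norm)
  ultimately show ?thesis by (rule borel_measurable_AE_eq)
qed

section \<open>L^p bounds under extension, gluing, translation and limits\<close>

text \<open>
  The bound \<open>R\<close> stands for an upper bound of the norm, see \<open>Lp_bdd_iff\<close> below; in this form it
  can be handled without the junk values of \<^const>\<open>enn2real\<close> and \<^const>\<open>esssup\<close>.
\<close>

definition Lp_bdd :: "ennreal \<Rightarrow> 'a measure \<Rightarrow> ('a \<Rightarrow> 'u::real_normed_vector) \<Rightarrow> real \<Rightarrow> bool" where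
  "Lp_bdd p M u R \<longleftrightarrow> strongly_measurable M u \<and>
     (if p = \<infinity> then AE x in M. norm (u x) \<le> R
      else (\<integral>\<^sup>+x. ennreal (norm (u x) powr enn2real p) \<partial>M) \<le> ennreal (R powr enn2real p))"

lemma Lp_bdd_strongly_measurable: "Lp_bdd p M u R \<Longrightarrow> strongly_measurable M u"
  by (simp add: Lp_bdd_def)

lemma enn2real_ge_1: "1 \<le> p \<Longrightarrow> p \<noteq> \<infinity> \<Longrightarrow> 1 \<le> enn2real p"
  by (cases p) (auto simp: top_ennreal_def[symmetric])

lemma (in complete_measure) Lp_bdd_iff:
  assumes p: "1 \<le> p" and R: "0 \<le> R"
  shows "Lp_bdd p M u R \<longleftrightarrow> u \<in> Lp p M \<and> Lp_norm p M u \<le> R"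
proof (cases "p = \<infinity>")
  case True
  let ?f = "\<lambda>x. ennreal (norm (u x))"
  have iff: "(AE x in M. norm (u x) \<le> R) \<longleftrightarrow> esssup M ?f < \<infinity> \<and> enn2real (esssup M ?f) \<le> R"
    if "strongly_measurable M u"
  proof
    have f: "?f \<in> borel_measurable M" using strongly_measurable_norm[OF that] by simp
    assume "AE x in M. norm (u x) \<le> R"
    then have "AE x in M. ?f x \<le> ennreal R" by (auto elim!: eventually_mono intro: ennreal_leI)
    from esssup_I[OF f this] show "esssup M ?f < \<infinity> \<and> enn2real (esssup M ?f) \<le> R"
      using R by (auto intro: enn2real_leI order_le_less_trans)
  next
    assume *: "esssup M ?f < \<infinity> \<and> enn2real (esssup M ?f) \<le> R"
    \<comment> \<open>Finiteness matters here: \<open>enn2real\<close> sends infinity to 0.\<close>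
    then have "esssup M ?f \<le> ennreal R"
      using R by (cases "esssup M ?f") auto
    with esssup_AE[of ?f M] show "AE x in M. norm (u x) \<le> R"
      using R by (auto elim!: eventually_mono dest: order_trans)
  qed
  then show ?thesis using True unfolding Lp_bdd_def Lp_def Lp_norm_def by auto
next
  case False
  define q where "q = enn2real p"
  have q: "1 \<le> q" using p False unfolding q_def by (rule enn2real_ge_1)
  define I where "I = (\<integral>\<^sup>+x. ennreal (norm (u x) powr q) \<partial>M)"
  have "I \<le> ennreal (R powr q) \<longleftrightarrow> I < \<infinity> \<and> enn2real I powr (1 / q) \<le> R"
  proof (cases I)
    case (real r)
    have "r \<le> R powr q \<longleftrightarrow> r powr (1/q) \<le> R"
    proof
      assume "r \<le> R powr q"
      then have "r powr (1/q) \<le> (R powr q) powr (1/q)" using real q by (intro powr_mono2) auto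
      then show "r powr (1/q) \<le> R" using R q by (simp add: powr_powr)
    next
      assume "r powr (1/q) \<le> R"
      then have "(r powr (1/q)) powr q \<le> R powr q" using q by (intro powr_mono2) auto
      then show "r \<le> R powr q" using real q by (simp add: powr_powr)
    qed
    then show ?thesis using real by (simp )
  \<comment> \<open>An infinite \<open>I\<close> violates both sides.\<close>
  qed (auto simp: top_unique)
  then show ?thesis using False
    unfolding Lp_bdd_def Lp_def Lp_norm_def q_def I_def by auto
qed

text \<open>The values 0 off \<open>S\<close> add nothing to the integral and respect the bound
  \<open>R \<ge> 0\<close>. Questions thus move to the whole line, where translations act.\<close>

lemma Lp_bdd_zero_extension_iff:
  assumes "S \<in> sets lebesgue" "0 \<le> R" "1 \<le> p"
  shows "Lp_bdd p (lebesgue_on S) f R \<longleftrightarrow> Lp_bdd p lebesgue (zero_extension S f) R"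
proof -
  have S: "S \<inter> space lebesgue \<in> sets lebesgue" using assms by simp
  have "(AE x in lebesgue_on S. norm (f x) \<le> R) \<longleftrightarrow> (AE x in lebesgue. norm (zero_extension S f x) \<le> R)"
    using assms(2) unfolding AE_restrict_space_iff[OF S]
    by (intro AE_cong) (auto simp: zero_extension_def)
  moreover have "(\<integral>\<^sup>+x. ennreal (norm (f x) powr q) \<partial>lebesgue_on S)
      = (\<integral>\<^sup>+x. ennreal (norm (zero_extension S f x) powr q) \<partial>lebesgue)" if "1 \<le> q" for q
    unfolding nn_integral_restrict_space[OF S] using that
    by (intro nn_integral_cong) (auto simp: zero_extension_def indicator_def)
  ultimately show ?thesis
    using enn2real_ge_1[OF assms(3)] strongly_measurable_zero_extension[OF assms(1)]
    unfolding Lp_bdd_def by auto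
qed

text \<open>The q-th power of the glued norm is at most the sum of the two q-th powers, and
  \<open>t powr q\<close> is superadditive for q at least 1, so the bounds add.\<close>

lemma Lp_bdd_glue:
  fixes u v :: "real \<Rightarrow> 'u::real_normed_vector"
  assumes u: "Lp_bdd p lebesgue u A" and v: "Lp_bdd p lebesgue v B"
    and "0 \<le> A" "0 \<le> B" "1 \<le> p" and S: "S \<in> sets lebesgue"
  shows "Lp_bdd p lebesgue (\<lambda>x. if x \<in> S then u x else v x) (A + B)"
proof -
  let ?w = "\<lambda>x. if x \<in> S then u x else v x"
  let ?j = "\<lambda>x. if x \<in> S then 0 else 1 :: nat"
  have j: "?j \<in> measurable lebesgue (count_space UNIV)"
    using S by measurable
  have "strongly_measurable lebesgue (\<lambda>x. (if ?j x = 0 then u else v) x)"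
    by (rule strongly_measurable_glue[where F="\<lambda>i. if i = 0 then u else v", OF _ j])
      (use u v in \<open>auto simp: Lp_bdd_def\<close>)
  then have sm: "strongly_measurable lebesgue ?w"
    by (rule back_subst[of "strongly_measurable lebesgue"]) auto
  show ?thesis
  proof (cases "p = \<infinity>")
    case True
    have "AE x in lebesgue. norm (?w x) \<le> A + B"
      using u v True assms(3,4) unfolding Lp_bdd_def by (auto elim!: eventually_elim2)
    then show ?thesis using sm True by (simp add: Lp_bdd_def)
  next
    case False
    define q where "q = enn2real p"
    have q: "1 \<le> q" using assms(5) False unfolding q_def by (rule enn2real_ge_1)
    have meas: "(\<lambda>x. ennreal (norm (h x) powr q)) \<in> borel_measurable lebesgue"
      if "strongly_measurable lebesgue h" for h :: "real \<Rightarrow> 'u"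
      using completion.strongly_measurable_norm[OF that] by measurable
    have "(\<integral>\<^sup>+x. ennreal (norm (?w x) powr q) \<partial>lebesgue)
        \<le> (\<integral>\<^sup>+x. ennreal (norm (u x) powr q) + ennreal (norm (v x) powr q) \<partial>lebesgue)"
      by (intro nn_integral_mono) auto
    also have "\<dots> = (\<integral>\<^sup>+x. ennreal (norm (u x) powr q) \<partial>lebesgue)
        + (\<integral>\<^sup>+x. ennreal (norm (v x) powr q) \<partial>lebesgue)"
      using u v by (intro nn_integral_add meas) (erule Lp_bdd_strongly_measurable)+
    also have "\<dots> \<le> ennreal (A powr q) + ennreal (B powr q)"
      using u v False by (intro add_mono) (auto simp: Lp_bdd_def q_def)
    also have "\<dots> = ennreal (A powr q + B powr q)" by simp
    also have "\<dots> \<le> ennreal ((A + B) powr q)"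
    proof (rule ennreal_leI)
      have "A powr q = A * A powr (q - 1)" if "A > 0" for A :: real
        using that by (simp add: powr_diff)
      then have eq: "A powr q = A * A powr (q - 1)" if "A \<ge> 0" for A :: real
        using that by (cases "A = 0") auto
      \<comment> \<open>Superadditivity: split off one factor and enlarge the base of the remaining
        power to \<open>A + B\<close>.\<close>
      have "A * A powr (q - 1) + B * B powr (q - 1)
          \<le> A * (A + B) powr (q - 1) + B * (A + B) powr (q - 1)"
        using assms(3,4) q by (intro add_mono mult_left_mono powr_mono2) auto
      then show "A powr q + B powr q \<le> (A + B) powr q"
        using assms(3,4) eq[of A] eq[of B] eq[of "A + B"] by (simp add: distrib_right)
    qed
    finally show ?thesis using sm False by (simp add: Lp_bdd_def q_def)
  qed
qed

lemma Lp_bdd_translate: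
  fixes \<tau> :: real
  assumes u: "Lp_bdd p lebesgue u R"
  shows "Lp_bdd p lebesgue (\<lambda>x. u (x - \<tau>)) R"
proof -
  have T: "(\<lambda>x. x - \<tau>) \<in> lebesgue \<rightarrow>\<^sub>M lebesgue"
    using lebesgue_affine_measurable[where c="\<lambda>_::real. 1" and t="- \<tau>"] by simp
  \<comment> \<open>Translation invariance in this form carries almost-everywhere statements through
    the shift.\<close>
  have lebesgue_eq: "distr lebesgue lebesgue (\<lambda>x. x - \<tau>) = lebesgue"
    using lebesgue_real_affine[of 1 "- \<tau>", symmetric] by (simp add: density_1)
  have AE: "AE x in lebesgue. Q (x - \<tau>)" if "AE x in lebesgue. Q x" for Q
    by (rule AE_distrD[OF T]) (simp only: lebesgue_eq that)
  obtain s where s: "\<And>n. simple_function lebesgue (s n)"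
    and lim: "AE x in lebesgue. (\<lambda>n. s n x) \<longlonglongrightarrow> u x"
    using Lp_bdd_strongly_measurable[OF u] strongly_measurableE by metis
  have "simple_function lebesgue (\<lambda>x. s n (x - \<tau>))" for n
    unfolding simple_function_eq_measurable
  proof
    show "finite ((\<lambda>x. s n (x - \<tau>)) ` space lebesgue)"
      using simple_functionD(1)[OF s[of n]] by (rule finite_subset[rotated]) auto
    show "(\<lambda>x. s n (x - \<tau>)) \<in> lebesgue \<rightarrow>\<^sub>M count_space UNIV"
      using measurable_compose[OF T measurable_simple_function[OF s]] .
  qed
  then have sm: "strongly_measurable lebesgue (\<lambda>x. u (x - \<tau>))"
    using AE[OF lim] by (rule strongly_measurableI)
  have "(\<lambda>x. norm (u x)) \<in> borel_measurable lebesgue"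
    using u by (intro completion.strongly_measurable_norm) (simp add: Lp_bdd_def)
  then have "(\<integral>\<^sup>+x. ennreal (norm (u (x - \<tau>)) powr q) \<partial>lebesgue)
      = (\<integral>\<^sup>+x. ennreal (norm (u x) powr q) \<partial>lebesgue)" for q
    using nn_integral_real_affine_lebesgue[of "\<lambda>x. ennreal (norm (u x) powr q)" 1 "- \<tau>"] by simp
  then show ?thesis using sm u AE[of "\<lambda>x. norm (u x) \<le> R"] unfolding Lp_bdd_def by auto
qed

text \<open>Fatou's lemma for finite p; for infinite p the countably many exceptional sets are
  united. An eventual inequality of norms is assumed instead of convergence because the partial
  controls need not vanish after the final time, whereas their limit does.\<close>

lemma Lp_bdd_liminf:
  assumes U: "\<And>n::nat. Lp_bdd p M (U n) R" and sm: "strongly_measurable M u"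
    and le: "\<And>x. x \<in> space M \<Longrightarrow> \<forall>\<^sub>F n in sequentially. norm (u x) \<le> norm (U n x)"
    and M: "complete_measure M"
  shows "Lp_bdd p M u R"
proof (cases "p = \<infinity>")
  case True
  have "AE x in M. \<forall>n. norm (U n x) \<le> R"
    using U True by (simp add: AE_all_countable Lp_bdd_def)
  then have "AE x in M. norm (u x) \<le> R"
    using AE_space
  proof eventually_elim
    case (elim x)
    then show ?case
      using eventually_happens'[OF sequentially_bot le[of x]] order_trans by blast
  qed
  then show ?thesis using sm True by (simp add: Lp_bdd_def)
next
  case False
  define q where "q = enn2real p"
  have q: "0 \<le> q" by (simp add: q_def)
  have "(\<integral>\<^sup>+x. ennreal (norm (u x) powr q) \<partial>M)
      \<le> (\<integral>\<^sup>+x. liminf (\<lambda>n. ennreal (norm (U n x) powr q)) \<partial>M)"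
    using q by (intro nn_integral_mono Liminf_bounded)
      (auto dest!: le elim!: eventually_mono intro!: ennreal_leI powr_mono2)
  also have "\<dots> \<le> liminf (\<lambda>n. \<integral>\<^sup>+x. ennreal (norm (U n x) powr q) \<partial>M)"
  proof (rule nn_integral_liminf)
    fix n
    have "(\<lambda>x. norm (U n x)) \<in> borel_measurable M"
      using U complete_measure.strongly_measurable_norm[OF M] by (auto simp: Lp_bdd_def)
    then show "(\<lambda>x. ennreal (norm (U n x) powr q)) \<in> borel_measurable M" by measurable
  qed
  also have "\<dots> \<le> liminf (\<lambda>n::nat. ennreal (R powr q))"
    using U False by (intro Liminf_mono always_eventually) (auto simp: Lp_bdd_def q_def)
  also have "\<dots> = ennreal (R powr q)" by (simp add: Liminf_const)
  finally show ?thesis using sm False by (simp add: Lp_bdd_def q_def)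
qed

lemma Lp_bdd_0: "1 \<le> p \<Longrightarrow> Lp_bdd p M (\<lambda>_. 0) 0"
  using enn2real_ge_1[of p] by (auto simp: Lp_bdd_def strongly_measurable_0)

section \<open>The L^p spaces on the half-line: zero, concatenation, restriction\<close>

lemma Lp_Rplus_iff: "1 \<le> p \<Longrightarrow> 0 \<le> R \<Longrightarrow> Lp_bdd p Rplus u R \<longleftrightarrow> u \<in> Lp p Rplus \<and> Lp_norm p Rplus u \<le> R"
  by (intro complete_measure.Lp_bdd_iff complete_measure_lebesgue_on) simp_all

lemma Lp_norm_nonneg: "0 \<le> Lp_norm p M u"
  by (simp add: Lp_norm_def)

lemma Lp_0:
  assumes "1 \<le> p"
  shows "(\<lambda>_. 0::'u::real_normed_vector) \<in> Lp p Rplus" "Lp_norm p Rplus (\<lambda>_. 0::'u) = 0"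
  using Lp_bdd_0[OF assms, of Rplus, where ?'b='u] Lp_norm_nonneg[of p Rplus "\<lambda>_. 0::'u"]
  by (auto simp: Lp_Rplus_iff assms)

lemma concatenation_Lp:
  assumes p: "1 \<le> p" and \<tau>: "0 \<le> \<tau>" and u: "u \<in> Lp p Rplus" and v: "v \<in> Lp p Rplus"
  shows "concatenation \<tau> u v \<in> Lp p Rplus"
    and "Lp_norm p Rplus (concatenation \<tau> u v) \<le> Lp_norm p Rplus u + Lp_norm p Rplus v"
proof -
  have bdd: "Lp_bdd p lebesgue (zero_extension {0..} w) (Lp_norm p Rplus w)" if "w \<in> Lp p Rplus" for w :: "real \<Rightarrow> 'a"
    using that p by (subst Lp_bdd_zero_extension_iff[symmetric]) (auto simp: Lp_Rplus_iff Lp_norm_nonneg)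
  \<comment> \<open>On the whole line a concatenation glues \<open>u\<close> to a translate of
    \<open>v\<close>; as \<tau> is nonnegative, negative times fall to the zero part of
    \<open>u\<close>.\<close>
  have "Lp_bdd p lebesgue (\<lambda>s. if s \<in> {..<\<tau>} then zero_extension {0..} u s
      else zero_extension {0..} v (s - \<tau>)) (Lp_norm p Rplus u + Lp_norm p Rplus v)"
    by (intro Lp_bdd_glue Lp_bdd_translate bdd u v p Lp_norm_nonneg) auto
  also have "(\<lambda>s. if s \<in> {..<\<tau>} then zero_extension {0..} u s else zero_extension {0..} v (s - \<tau>))
      = zero_extension {0..} (concatenation \<tau> u v)"
    using \<tau> by (auto simp: zero_extension_def concatenation_def)
  finally have "Lp_bdd p Rplus (concatenation \<tau> u v) (Lp_norm p Rplus u + Lp_norm p Rplus v)"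
    using p by (subst Lp_bdd_zero_extension_iff) (auto intro: add_nonneg_nonneg Lp_norm_nonneg)
  then show "concatenation \<tau> u v \<in> Lp p Rplus"
    "Lp_norm p Rplus (concatenation \<tau> u v) \<le> Lp_norm p Rplus u + Lp_norm p Rplus v"
    using p by (auto simp: Lp_Rplus_iff Lp_norm_nonneg)
qed

lemma Lp_restrict:
  assumes p: "1 \<le> p" and u: "u \<in> Lp p Rplus" and S: "S \<in> sets lebesgue" "S \<subseteq> {0..}"
  shows "u \<in> Lp p (lebesgue_on S)" "Lp_norm p (lebesgue_on S) u \<le> Lp_norm p Rplus u"
    "zero_extension S u \<in> Lp p Rplus"
proof -
  have "Lp_bdd p lebesgue (zero_extension {0..} u) (Lp_norm p Rplus u)"
    using u p by (subst Lp_bdd_zero_extension_iff[symmetric]) (auto simp: Lp_Rplus_iff Lp_norm_nonneg)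
  \<comment> \<open>Restricting means gluing with the zero function, whose bound 0 leaves the norm
    bound unchanged.\<close>
  from Lp_bdd_glue[OF this Lp_bdd_0[OF p] Lp_norm_nonneg order_refl p S(1)]
  have "Lp_bdd p lebesgue (\<lambda>x. if x \<in> S then zero_extension {0..} u x else 0) (Lp_norm p Rplus u)"
    by simp
  also have "(\<lambda>x. if x \<in> S then zero_extension {0..} u x else 0) = zero_extension S u"
    using S by (fastforce simp: zero_extension_def fun_eq_iff)
  finally have bdd: "Lp_bdd p lebesgue (zero_extension S u) (Lp_norm p Rplus u)" .
  then have "Lp_bdd p (lebesgue_on S) u (Lp_norm p Rplus u)"
    using S p by (simp add: Lp_bdd_zero_extension_iff Lp_norm_nonneg)
  then show "u \<in> Lp p (lebesgue_on S)" "Lp_norm p (lebesgue_on S) u \<le> Lp_norm p Rplus u"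
    using complete_measure.Lp_bdd_iff[OF complete_measure_lebesgue_on[OF S(1)] p] Lp_norm_nonneg
    by blast+
  have "zero_extension {0..} (zero_extension S u) = zero_extension S u"
    using S by (fastforce simp: zero_extension_def fun_eq_iff)
  with bdd have "Lp_bdd p Rplus (zero_extension S u) (Lp_norm p Rplus u)"
    using p by (subst Lp_bdd_zero_extension_iff) (auto simp: Lp_norm_nonneg)
  then show "zero_extension S u \<in> Lp p Rplus"
    using p by (simp add: Lp_Rplus_iff Lp_norm_nonneg)
qed

section \<open>Abstract linear control systems\<close>

text \<open>Banach-Steinhaus by Baire category: the closed sets \<open>D n\<close> cover the space,
  so one of them contains a ball, and linearity moves the bound on this ball to the origin.\<close>

lemma uniform_boundedness:
  fixes F :: "'i \<Rightarrow> 'a::banach \<Rightarrow> 'b::real_normed_vector"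
  assumes lin: "\<And>i. i \<in> I \<Longrightarrow> bounded_linear (F i)"
    and pointwise: "\<And>x. \<exists>c. \<forall>i\<in>I. norm (F i x) \<le> c"
  shows "\<exists>K. \<forall>i\<in>I. \<forall>x. norm (F i x) \<le> K * norm x"
proof -
  define D where "D n = {x. \<forall>i\<in>I. norm (F i x) \<le> real n}" for n
  have closed: "closed (D n)" for n
  proof -
    have "D n = (\<Inter>i\<in>I. {x. norm (F i x) \<le> real n})" by (auto simp: D_def)
    also have "closed \<dots>"
      using lin
      by (intro closed_INT ballI closed_Collect_le continuous_intros) (auto intro: linear_continuous_on)
    finally show ?thesis .
  qed
  have "\<Union>(range D) = UNIV"
  proof -
    have "x \<in> \<Union>(range D)" for x
    proof -
      obtain c where "\<forall>i\<in>I. norm (F i x) \<le> c" using pointwise by blast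
      moreover obtain n where "c \<le> real n" using real_arch_simple by blast
      ultimately have "x \<in> D n" unfolding D_def by force
      then show ?thesis by blast
    qed
    then show ?thesis by blast
  qed
  moreover have "interior (\<Union>(range D)) = {}" if "\<And>n. interior (D n) = {}"
    using Met_TC.metric_Baire_category_alt[where ?'a='a, of "range D"] closed that
    by (force simp: complete_UNIV)
  ultimately have "\<exists>n. interior (D n) \<noteq> {}" by auto
  then obtain n x0 where "x0 \<in> interior (D n)" by blast
  then obtain e where e: "e > 0" "ball x0 e \<subseteq> D n" by (meson mem_interior)
  have "norm (F i x) \<le> (4 * real n / e) * norm x" if i: "i \<in> I" for i x
  proof (cases "x = 0")
    case True
    then show ?thesis using bounded_linear.linear[OF lin[OF i]] by (simp add: linear_0)
  next
    case False
    interpret bounded_linear "F i" using lin[OF i] .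
    \<comment> \<open>Rescaled to length e/2, \<open>x\<close> keeps
      \<open>x0 + c *\<^sub>R x\<close> inside the ball. Two values bounded by n differ by at most
      2n, whence the constant 4n/e.\<close>
    define c where "c = e / (2 * norm x)"
    have c: "c > 0" using e False by (simp add: c_def)
    have "x0 \<in> D n" "x0 + c *\<^sub>R x \<in> D n"
      using e False by (auto simp: c_def dist_norm intro!: subsetD[OF e(2)])
    then have *: "norm (F i x0) \<le> n" "norm (F i (x0 + c *\<^sub>R x)) \<le> n"
      using i by (auto simp: D_def)
    have "c * norm (F i x) = norm (F i (x0 + c *\<^sub>R x) - F i x0)"
      using c by (simp add: add scaleR)
    also have "\<dots> \<le> 2 * n"
      using * norm_triangle_ineq4[of "F i (x0 + c *\<^sub>R x)" "F i x0"] by linarith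
    finally show ?thesis using e False by (simp add: c_def field_simps)
  qed
  then show ?thesis by blast
qed

section \<open>Causality, uniform bounds in time and the iteration of controls\<close>

context abstract_linear_control_system
begin

text \<open>Causality, from the concatenation axiom with remaining time 0: a control may be altered
  after \<tau> without changing the state at \<tau>.\<close>

lemma concatenation_eq:
  assumes "0 \<le> \<tau>" "u \<in> Lp p Rplus" "v \<in> Lp p Rplus"
  shows "\<Sigma> \<tau> (y, concatenation \<tau> u v) = \<Sigma> \<tau> (y, u)"
  using concat[of 0 \<tau> u v y] assms initial by simp

lemma zero_extension_eq:
  assumes T: "0 < T" and u: "u \<in> Lp p Rplus"
  shows "\<Sigma> T (y, zero_extension {0<..<T} u) = \<Sigma> T (y, u)"
proof -
  let ?w = "zero_extension {0<..<T} u"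
  have w: "?w \<in> Lp p Rplus"
    by (rule Lp_restrict(3)[OF exponent u]) auto
  note zero = Lp_0(1)[OF exponent, where ?'u='u]
  have "\<Sigma> T (y, ?w) = \<Sigma> T (y, concatenation T ?w (\<lambda>_. 0))"
    using concatenation_eq T w zero by simp
  also have "\<dots> = \<Sigma> T (y, concatenation T u (\<lambda>_. 0))"
  proof (rule AE_cong)
    \<comment> \<open>Before \<open>T\<close> the two controls can differ only at the endpoint 0,
      which the open interval omits.\<close>
    have "{0::real} \<in> null_sets lebesgue" by simp
    then have "AE s in lebesgue. s \<noteq> (0::real)"
      using AE_not_in by fastforce
    then show "AE s in Rplus. concatenation T ?w (\<lambda>_. 0) s = concatenation T u (\<lambda>_. 0) s"
      by (simp add: AE_restrict_space_iff)
        (auto simp: concatenation_def zero_extension_def elim!: eventually_mono)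
  qed (use T u w zero in \<open>auto intro!: concatenation_Lp exponent\<close>)
  also have "\<dots> = \<Sigma> T (y, u)"
    using concatenation_eq T u zero by simp
  finally show ?thesis .
qed

text \<open>The iteration runs over infinitely many durations, so the time-dependent constants of
  \<open>bounded\<close> must be made uniform. By linearity the initial state and the control are
  treated separately: the former by uniform boundedness, as trajectories are bounded on [0,1] by
  continuity, the latter by a delay.\<close>

lemma uniform_bound:
  obtains K where "K > 0"
    "\<And>t y u. 0 \<le> t \<Longrightarrow> t \<le> 1 \<Longrightarrow> u \<in> Lp p Rplus \<Longrightarrow> norm (\<Sigma> t (y, u)) \<le> K * (norm y + Lp_norm p Rplus u)"
proof -
  note zero = Lp_0[OF exponent, where ?'u='u]
  have lin: "bounded_linear (\<lambda>y. \<Sigma> t (y, \<lambda>_. 0))" if t: "0 \<le> t" for t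
  proof
    obtain K where "\<forall>y. \<forall>u\<in>Lp p Rplus. norm (\<Sigma> t (y, u)) \<le> K * (norm y + Lp_norm p Rplus u)"
      using bounded[OF t] by blast
    then have "norm (\<Sigma> t (y, \<lambda>_. 0)) \<le> norm y * K" for y
      using zero by (fastforce simp: mult.commute)
    then show "\<exists>K. \<forall>y. norm (\<Sigma> t (y, \<lambda>_. 0)) \<le> norm y * K" by blast
  qed (use add[OF t zero(1) zero(1)] scale[OF t zero(1)] in auto)
  have "\<exists>c. \<forall>t\<in>{0..1}. norm (\<Sigma> t (y, \<lambda>_. 0)) \<le> c" for y
  proof -
    have "compact ((\<lambda>t. \<Sigma> t (y, \<lambda>_. 0)) ` {0..1})"
      using continuous[OF zero(1)] by (intro compact_continuous_image) (rule continuous_on_subset, auto)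
    then have "bounded ((\<lambda>t. \<Sigma> t (y, \<lambda>_. 0)) ` {0..1})" by (rule compact_imp_bounded)
    then show ?thesis by (simp add: bounded_iff)
  qed
  then have "\<exists>K. \<forall>t\<in>{0..1}. \<forall>y. norm (\<Sigma> t (y, \<lambda>_. 0)) \<le> K * norm y"
    using lin by (intro uniform_boundedness) auto
  then obtain K1 where K1: "\<And>t y. t \<in> {0..1} \<Longrightarrow> norm (\<Sigma> t (y, \<lambda>_. 0)) \<le> K1 * norm y"
    by blast
  obtain K2 where K2: "\<And>y u. u \<in> Lp p Rplus \<Longrightarrow> norm (\<Sigma> 1 (y, u)) \<le> K2 * (norm y + Lp_norm p Rplus u)"
    using bounded[of 1] by auto
  \<comment> \<open>The signs of \<open>K1\<close> and \<open>K2\<close> are unknown; the summand 1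
    makes \<open>K\<close> positive.\<close>
  define K where "K = \<bar>K1\<bar> + \<bar>K2\<bar> + 1"
  have "norm (\<Sigma> t (y, u)) \<le> K * (norm y + Lp_norm p Rplus u)"
    if t: "0 \<le> t" "t \<le> 1" and u: "u \<in> Lp p Rplus" for t y u
  proof -
    have z: "\<Sigma> s (0, \<lambda>_. 0) = 0" if "0 \<le> s" for s
      using linear_0[OF bounded_linear.linear[OF lin[OF that]]] .
    \<comment> \<open>Delaying the control until \<open>1 - t\<close> reduces the bound for \<open>\<Sigma> t (0, u)\<close> to the single time 1.\<close>
    let ?w = "concatenation (1 - t) (\<lambda>_. 0) u"
    have w: "?w \<in> Lp p Rplus" "Lp_norm p Rplus ?w \<le> Lp_norm p Rplus u"
      using concatenation_Lp[OF exponent, of "1 - t" "\<lambda>_. 0" u] t u zero by auto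
    have "\<Sigma> t (0, u) = \<Sigma> 1 (0, ?w)"
      using concat[of t "1 - t" "\<lambda>_. 0" u 0] t u zero z by simp
    also have "norm \<dots> \<le> K2 * Lp_norm p Rplus ?w"
      using K2[OF w(1), of 0] by simp
    also have "\<dots> \<le> K * Lp_norm p Rplus u"
      using w(2) Lp_norm_nonneg[of p Rplus ?w] unfolding K_def by (intro mult_mono) auto
    finally have 1: "norm (\<Sigma> t (0, u)) \<le> K * Lp_norm p Rplus u" .
    have 2: "norm (\<Sigma> t (y, \<lambda>_. 0)) \<le> K * norm y"
    proof -
      have "norm (\<Sigma> t (y, \<lambda>_. 0)) \<le> K1 * norm y" using K1 t by simp
      also have "\<dots> \<le> K * norm y" unfolding K_def by (intro mult_right_mono) auto
      finally show ?thesis .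
    qed
    have "\<Sigma> t (y, u) = \<Sigma> t (y, \<lambda>_. 0) + \<Sigma> t (0, u)"
      using add[OF t(1) zero(1) u, of y 0] by simp
    then have "norm (\<Sigma> t (y, u)) \<le> norm (\<Sigma> t (y, \<lambda>_. 0)) + norm (\<Sigma> t (0, u))"
      by (simp add: norm_triangle_ineq)
    with 1 2 show ?thesis by (simp add: distrib_left)
  qed
  moreover have "K > 0" by (simp add: K_def)
  ultimately show ?thesis using that by blast
qed

text \<open>Here \<open>e n\<close> bounds the state at the n-th switching time relative to
  \<open>norm y0\<close>, so the n-th piece costs at most \<open>\<alpha> n * e n\<close> in the
  same unit and \<open>R\<close> bounds the total. The switching times converge to \<open>T\<close>,
  where the state vanishes by continuity.\<close>

lemma null_control_iteration:
  fixes \<tau> \<alpha> \<delta> e :: "nat \<Rightarrow> real"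
  assumes \<tau>: "\<And>n. 0 \<le> \<tau> n" "\<tau> sums T"
    and step: "\<And>n y. \<exists>v\<in>Lp p Rplus.
      Lp_norm p Rplus v \<le> \<alpha> n * norm y \<and> norm (\<Sigma> (\<tau> n) (y, v)) \<le> \<delta> n * norm y"
    and \<alpha>: "\<And>n. 0 \<le> \<alpha> n" and \<delta>: "\<And>n. 0 \<le> \<delta> n"
    and e: "e 0 = 1" "\<And>n. \<delta> n * e n \<le> e (Suc n)" "e \<longlonglongrightarrow> 0"
    and R: "\<And>n. (\<Sum>i<n. \<alpha> i * e i) \<le> R"
  shows "\<exists>u\<in>Lp p Rplus. \<Sigma> T (y0, u) = 0 \<and> Lp_norm p Rplus u \<le> R * norm y0"
proof -
  define t where "t n = (\<Sum>i<n. \<tau> i)" for n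
  have t_lim: "t \<longlonglongrightarrow> T" using \<tau>(2) unfolding sums_def t_def .
  have t_Suc: "t (Suc n) = t n + \<tau> n" for n by (simp add: t_def)
  have t_nonneg: "0 \<le> t n" for n unfolding t_def using \<tau>(1) by (intro sum_nonneg)
  have t_mono: "incseq t" using \<tau>(1) by (intro incseq_SucI) (simp add: t_Suc)
  have t_le: "t n \<le> T" for n using incseq_le[OF t_mono t_lim] .
  obtain V where V: "\<And>n y. V n y \<in> Lp p Rplus"
    "\<And>n y. Lp_norm p Rplus (V n y) \<le> \<alpha> n * norm y"
    "\<And>n y. norm (\<Sigma> (\<tau> n) (y, V n y)) \<le> \<delta> n * norm y"
    using step by metis
  define Y where "Y = rec_nat y0 (\<lambda>n y. \<Sigma> (\<tau> n) (y, V n y))"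
  have Y: "Y 0 = y0" "\<And>n. Y (Suc n) = \<Sigma> (\<tau> n) (Y n, V n (Y n))" by (simp_all add: Y_def)
  \<comment> \<open>The control \<open>U n\<close> is final on [0, \<open>t n\<close>); the next
    concatenation overwrites everything later.\<close>
  define U where "U = rec_nat (\<lambda>_. 0) (\<lambda>n w. concatenation (t n) w (V n (Y n)))"
  have U: "U 0 = (\<lambda>_. 0)" "\<And>n. U (Suc n) = concatenation (t n) (U n) (V n (Y n))"
    by (simp_all add: U_def)
  have Y_le: "norm (Y n) \<le> e n * norm y0" for n
  proof (induction n)
    case (Suc n)
    have "norm (Y (Suc n)) \<le> \<delta> n * norm (Y n)" using V(3) by (simp add: Y)
    also have "\<dots> \<le> \<delta> n * (e n * norm y0)" using Suc \<delta> by (intro mult_left_mono)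
    also have "\<dots> \<le> e (Suc n) * norm y0"
      using e(2)[of n] by (simp flip: mult.assoc add: mult_right_mono)
    finally show ?case .
  qed (simp add: Y e)
  have U_Lp: "U n \<in> Lp p Rplus" for n
    by (induction n) (auto simp: U Lp_0 exponent t_nonneg V intro!: concatenation_Lp)
  have "Lp_norm p Rplus (U n) \<le> (\<Sum>i<n. \<alpha> i * e i) * norm y0" for n
  proof (induction n)
    case (Suc n)
    have "Lp_norm p Rplus (U (Suc n)) \<le> Lp_norm p Rplus (U n) + Lp_norm p Rplus (V n (Y n))"
      unfolding U using exponent t_nonneg U_Lp V(1) by (rule concatenation_Lp)
    also have "Lp_norm p Rplus (V n (Y n)) \<le> \<alpha> n * (e n * norm y0)"
      using V(2)[of n "Y n"] mult_left_mono[OF Y_le[of n] \<alpha>[of n]] by linarith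
    finally show ?case using Suc by (simp add: distrib_right)
  qed (simp add: U Lp_0 exponent)
  then have U_norm: "Lp_norm p Rplus (U n) \<le> R * norm y0" for n
    using mult_right_mono[OF R[of n], of "norm y0"] by (meson norm_ge_zero order_trans)
  have R_nonneg: "0 \<le> R" using R[of 0] by simp
  have \<Sigma>_U: "\<Sigma> (t n) (y0, U n) = Y n" for n
  proof (induction n)
    case 0
    then show ?case by (simp add: U Y t_def initial Lp_0 exponent)
  next
    case (Suc n)
    then show ?case
      using concat[of "\<tau> n" "t n" "U n" "V n (Y n)" y0] \<tau>(1) t_nonneg U_Lp V(1)
      by (simp add: U Y t_Suc add.commute)
  qed
  have U_eq: "U k s = U n s" if "n \<le> k" "s < t n" for n k s
    using that(1)
  proof (induction k rule: dec_induct)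
    case (step k)
    then show ?case using that(2) monoD[OF t_mono, of n k] by (simp add: U concatenation_def)
  qed simp
  \<comment> \<open>The first switching time after \<open>s\<close> selects the piece. From
    \<open>T\<close> on there is none, and the default 0 selects \<open>U 0\<close>, the zero
    function.\<close>
  define j where "j s = (if s < T then LEAST n. s < t n else 0)" for s
  define u where "u s = U (j s) s" for s
  have u_eq: "u s = U n s" if "s < t n" for n s
  proof -
    have "j s = (LEAST n. s < t n)" using that t_le[of n] by (simp add: j_def)
    then have "s < t (j s)" "j s \<le> n" using that LeastI[of "\<lambda>n. s < t n"] Least_le[of "\<lambda>n. s < t n"] by auto
    then show ?thesis unfolding u_def using U_eq by metis
  qed
  have j: "j \<in> measurable Rplus (count_space UNIV)"
  proof -
    have less: "{s \<in> {0..}. s < c} \<in> sets Rplus" for c :: real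
    proof -
      have "{s \<in> {0..}. s < c} = {0..} \<inter> {..<c}" by auto
      then show ?thesis by (auto simp: sets_restrict_space)
    qed
    have "Measurable.pred Rplus (\<lambda>s. s < c)" for c :: real
      using less by (simp add: pred_def)
    then have "(\<lambda>s. LEAST n. s < t n) \<in> measurable Rplus (count_space UNIV)"
      by (rule measurable_Least)
    then show ?thesis
      unfolding j_def using less by (intro measurable_If) auto
  qed
  have "Lp_bdd p Rplus u (R * norm y0)"
  proof (rule Lp_bdd_liminf[of p Rplus U])
    show bdd: "Lp_bdd p Rplus (U n) (R * norm y0)" for n
      using U_Lp U_norm R_nonneg exponent by (simp add: Lp_Rplus_iff)
    show "strongly_measurable Rplus u"
      unfolding u_def using strongly_measurable_glue[OF Lp_bdd_strongly_measurable[OF bdd] j] .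
    show "\<forall>\<^sub>F n in sequentially. norm (u s) \<le> norm (U n s)" for s
    proof (cases "s < T")
      case True
      then have "\<forall>\<^sub>F n in sequentially. s < t n" using t_lim order_tendstoD(1) by blast
      then show ?thesis by eventually_elim (simp add: u_eq)
    next
      case False
      then show ?thesis by (simp add: u_def j_def U)
    qed
    show "complete_measure Rplus" by (rule complete_measure_lebesgue_on) simp
  qed
  then have u: "u \<in> Lp p Rplus" "Lp_norm p Rplus u \<le> R * norm y0"
    using R_nonneg exponent by (auto simp: Lp_Rplus_iff)
  \<comment> \<open>Both \<open>u\<close> and \<open>U n\<close> are padded with 0 after
    \<open>t n\<close>, before which they agree; causality then gives equal states.\<close>
  have \<Sigma>_u: "\<Sigma> (t n) (y0, u) = Y n" for n
  proof -
    have "concatenation (t n) u (\<lambda>_. 0) = concatenation (t n) (U n) (\<lambda>_. 0)"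
      by (auto simp: concatenation_def u_eq)
    then show ?thesis
      using concatenation_eq[OF t_nonneg u(1), of "\<lambda>_. 0"]
        concatenation_eq[OF t_nonneg U_Lp, of "\<lambda>_. 0"] \<Sigma>_U
      by (metis Lp_0(1) exponent)
  qed
  have "0 \<le> T" using t_nonneg t_le order_trans by blast
  then have "(\<lambda>n. \<Sigma> (t n) (y0, u)) \<longlonglongrightarrow> \<Sigma> T (y0, u)"
    using continuous_on_tendsto_compose[OF continuous[OF u(1)] t_lim] t_nonneg by simp
  moreover have "(\<lambda>n. \<Sigma> (t n) (y0, u)) \<longlonglongrightarrow> 0"
    unfolding \<Sigma>_u
  proof (rule Lim_null_comparison)
    show "(\<lambda>n. e n * norm y0) \<longlonglongrightarrow> 0" using tendsto_mult_left_zero[OF e(3)] .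
  qed (use Y_le in simp)
  ultimately show ?thesis using u LIMSEQ_unique by blast
qed

end

section \<open>The Lebeau--Robbiano iteration\<close>

text \<open>The choice of scales, separated from the control system. \<open>D\<close> stands for the
  constant of one control-and-dissipation step. As \<open>C\<^sub>0\<close> and
  \<open>c\<^sub>0\<close> must not depend on \<open>T\<close>, the whole dependence on
  \<open>T\<close> goes into the scale \<open>N\<close> of the frequencies and the lengths of the
  pieces.\<close>

lemma iteration_parameters:
  fixes C\<^sub>1 D c\<^sub>1 c\<^sub>2 a b m :: real
  assumes "C\<^sub>1 > 0" "D > 0" "c\<^sub>1 > 0" "c\<^sub>2 > 0" "a > 0" "m > 0" "a < b"
  shows "\<exists>C\<^sub>0>0. \<exists>c\<^sub>0>0. \<forall>T. 0 < T \<and> T \<le> 1 \<longrightarrow>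
    (\<exists>(k :: nat \<Rightarrow> nat) (\<tau> :: nat \<Rightarrow> real) (e :: nat \<Rightarrow> real).
      (\<forall>n. 0 < \<tau> n \<and> \<tau> n \<le> 1) \<and> \<tau> sums T \<and> e 0 = 1 \<and> e \<longlonglongrightarrow> 0 \<and>
      (\<forall>n. D * exp (c\<^sub>1 * real (k n) powr a - c\<^sub>2 * (\<tau> n / 2) powr m * real (k n) powr b) * e n
        \<le> e (Suc n)) \<and>
      (\<forall>n. (\<Sum>i<n. C\<^sub>1 * exp (c\<^sub>1 * real (k i) powr a) * e i)
        \<le> C\<^sub>0 * exp (c\<^sub>0 * T powr (- (a * m / (b - a))))))"
proof -
  define \<rho> r where "\<rho> = 2 powr a" and "r = 2 powr (- ((b - a) / m))"
  have \<rho>: "\<rho> > 1" unfolding \<rho>_def using assms by simp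
  have r: "0 < r" "r < 1" unfolding r_def using assms by (auto intro!: powr_less_one)
  \<comment> \<open>The surplus 1 in \<beta> leaves a factor \<open>exp (- x i)\<close> after the
    control cost is paid, so the total cost is dominated by a geometric series. \<gamma> collects
    the constants of \<open>(\<tau> n / 2) powr m\<close>.\<close>
  define \<beta> \<gamma> where "\<beta> = c\<^sub>1 * \<rho> + 1" and "\<gamma> = ((1 - r) / 2) powr m"
  have \<beta>: "\<beta> > 0" unfolding \<beta>_def using assms \<rho> by (simp add: add_pos_pos)
  have \<gamma>: "\<gamma> > 0" unfolding \<gamma>_def using r by simp
  \<comment> \<open>Dissipation of strength \<open>c\<^sub>2 * \<gamma> * A\<close> has to pay for
    the control cost \<open>c\<^sub>1 * \<rho>\<close>, the prescribed decay
    \<open>\<beta> * (\<rho> - 1)\<close> and the prefactor \<open>D\<close>.\<close>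
  define A where "A = 1 + (c\<^sub>1 * \<rho> + \<beta> * (\<rho> - 1) + D) / (c\<^sub>2 * \<gamma>)"
  have A: "A \<ge> 1" "c\<^sub>2 * \<gamma> * A \<ge> c\<^sub>1 * \<rho> + \<beta> * (\<rho> - 1) + D"
  proof -
    let ?z = "c\<^sub>1 * \<rho> + \<beta> * (\<rho> - 1) + D"
    have z: "?z > 0" using assms \<rho> \<beta> by (simp add: add_pos_pos)
    have g: "c\<^sub>2 * \<gamma> > 0" using assms \<gamma> by simp
    show "A \<ge> 1" unfolding A_def using z g by (simp del: zero_less_mult_iff)
    have "g * (1 + z / g) = g + z" if "g > 0" for g z :: real
      using that by (simp add: distrib_left)
    from this[OF g] have "c\<^sub>2 * \<gamma> * A = c\<^sub>2 * \<gamma> + ?z" unfolding A_def .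
    then show "c\<^sub>2 * \<gamma> * A \<ge> ?z" using g by linarith
  qed
  \<comment> \<open>\<open>c\<^sub>0\<close> turns \<open>\<beta> * N powr a\<close> into a multiple
    of the power of \<open>T\<close>; \<open>C\<^sub>0\<close> is \<open>C\<^sub>1\<close> times the
    sum of the powers of 1/\<rho>.\<close>
  define c\<^sub>0 C\<^sub>0 where "c\<^sub>0 = \<beta> * A powr (a / (b - a))" and "C\<^sub>0 = C\<^sub>1 * \<rho> / (\<rho> - 1)"
  have "C\<^sub>0 > 0" "c\<^sub>0 > 0" unfolding C\<^sub>0_def c\<^sub>0_def using assms \<rho> \<beta> A by auto
  moreover have "\<exists>(k :: nat \<Rightarrow> nat) (\<tau> :: nat \<Rightarrow> real) (e :: nat \<Rightarrow> real).
      (\<forall>n. 0 < \<tau> n \<and> \<tau> n \<le> 1) \<and> \<tau> sums T \<and> e 0 = 1 \<and> e \<longlonglongrightarrow> 0 \<and>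
      (\<forall>n. D * exp (c\<^sub>1 * real (k n) powr a - c\<^sub>2 * (\<tau> n / 2) powr m * real (k n) powr b) * e n
        \<le> e (Suc n)) \<and>
      (\<forall>n. (\<Sum>i<n. C\<^sub>1 * exp (c\<^sub>1 * real (k i) powr a) * e i) \<le> C\<^sub>0 * exp (c\<^sub>0 * T powr (- (a * m / (b - a)))))"
    if T: "0 < T" "T \<le> 1" for T
  proof -
    define N where "N = (A * T powr (- m)) powr (1 / (b - a))"
    have "1 \<le> T powr (- m)"
      using T assms powr_mono2'[of "- m" T 1] by simp
    then have base: "1 \<le> A * T powr (- m)" using A(1) mult_mono[of 1 A 1 "T powr (- m)"] by simp
    have N: "1 \<le> N" unfolding N_def using base assms by (intro ge_one_powr_ge_zero) auto
    have N_ba: "T powr m * N powr (b - a) = A"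
      unfolding N_def using T assms base by (simp add: powr_powr powr_minus)
    have Na: "N powr a = A powr (a / (b - a)) * T powr (- (a * m / (b - a)))"
      unfolding N_def using T A assms by (simp add: powr_powr powr_mult mult_ac)
    have Na_1: "1 \<le> N powr a" using N assms by (intro ge_one_powr_ge_zero) auto
    define x where "x n = N powr a * \<rho> ^ n" for n
    have x_ge: "\<rho> ^ n \<le> x n" for n unfolding x_def using Na_1 \<rho> by simp
    have x_1: "1 \<le> x n" for n using x_ge[of n] one_le_power[of \<rho> n] \<rho> by linarith
    \<comment> \<open>As \<open>N * 2 ^ n\<close> is at least 1, rounding up at most doubles it,
      which costs a factor \<open>2 powr a = \<rho>\<close> in the exponent.\<close>
    define k where "k n = nat \<lceil>N * 2 ^ n\<rceil>" for n
    have k_ge: "N * 2 ^ n \<le> real (k n)" for n unfolding k_def by linarith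
    have "1 \<le> N * 2 ^ n" for n
      using N mult_mono[of 1 N 1 "2 ^ n"] by simp
    then have k_le: "real (k n) \<le> 2 * (N * 2 ^ n)" for n
      unfolding k_def using ceiling_correct[of "N * 2 ^ n"] by (smt (verit) of_nat_nat zero_le_ceiling)
    have pow: "(2 ^ n) powr c = (2 powr c) ^ n" for c :: real and n :: nat
      by (simp add: powr_powr powr_realpow[symmetric] mult.commute)
    have ka: "real (k n) powr a \<le> \<rho> * x n" for n
    proof -
      have "real (k n) powr a \<le> (2 * (N * 2 ^ n)) powr a"
        using k_le assms by (intro powr_mono2) auto
      also have "\<dots> = \<rho> * x n" using N by (simp add: powr_mult x_def \<rho>_def pow)
      finally show ?thesis .
    qed
    define \<tau> where "\<tau> n = T * (1 - r) * r ^ n" for n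
    have \<tau>: "0 < \<tau> n" "\<tau> n \<le> 1" for n
    proof -
      show "0 < \<tau> n" unfolding \<tau>_def using T r by simp
      have "T * (1 - r) * r ^ n \<le> 1 * 1 * 1"
        using T r by (intro mult_mono power_le_one) auto
      then show "\<tau> n \<le> 1" by (simp add: \<tau>_def)
    qed
    have "\<tau> sums (T * (1 - r) * (1 / (1 - r)))"
      unfolding \<tau>_def using r by (intro sums_mult geometric_sums) auto
    then have sums: "\<tau> sums T" using r by simp
    have kb: "\<gamma> * A * x n \<le> (\<tau> n / 2) powr m * real (k n) powr b" for n
    proof -
      \<comment> \<open>This identity dictates \<open>r\<close>: shrinking lengths and growing
        frequencies combine to the growth rate of the cost exponent.\<close>
      have "r powr m * 2 powr b = \<rho>"
        unfolding r_def \<rho>_def using assms by (simp add: powr_powr flip: powr_add)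
      then have q: "(r powr m) ^ n * (2 powr b) ^ n = \<rho> ^ n" by (simp flip: power_mult_distrib)
      have rn: "(r ^ n) powr m = (r powr m) ^ n"
        using r by (simp add: powr_powr powr_realpow[symmetric] mult.commute)
      have Nb: "N powr b = N powr (b - a) * N powr a" by (simp flip: powr_add)
      have "(\<tau> n / 2) powr m * (N * 2 ^ n) powr b
        = (((1 - r) / 2) * T * r ^ n) powr m * (N * 2 ^ n) powr b"
        by (simp add: \<tau>_def mult_ac)
      also have "\<dots> = \<gamma> * (T powr m * N powr (b - a)) * N powr a * ((r powr m) ^ n * (2 powr b) ^ n)"
        using T r N by (simp only: powr_mult pow rn \<gamma>_def Nb mult_ac)
      also have "\<dots> = \<gamma> * A * x n" by (simp add: N_ba q x_def)
      finally have "\<gamma> * A * x n = (\<tau> n / 2) powr m * (N * 2 ^ n) powr b" by simp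
      also have "\<dots> \<le> (\<tau> n / 2) powr m * real (k n) powr b"
        using k_ge N assms by (intro mult_left_mono powr_mono2) auto
      finally show ?thesis .
    qed
    \<comment> \<open>Subtracting from \<open>N powr a\<close>, which is \<open>x 0\<close>,
      normalises \<open>e 0\<close> to 1.\<close>
    define e where "e n = exp (\<beta> * (N powr a - x n))" for n
    have x_Suc: "x (Suc n) = \<rho> * x n" for n by (simp add: x_def)
    have step: "D * exp (c\<^sub>1 * real (k n) powr a - c\<^sub>2 * (\<tau> n / 2) powr m * real (k n) powr b) * e n
        \<le> e (Suc n)" for n
    proof -
      \<comment> \<open>The prefactor is absorbed into the exponent, since \<open>x n\<close> is at
        least 1.\<close>
      have "D \<le> exp (D * x n)"
      proof -
        have "D * 1 \<le> D * x n" using x_1 assms by (intro mult_left_mono) auto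
        then show ?thesis using exp_ge_add_one_self[of "D * x n"] by linarith
      qed
      moreover have "exp (c\<^sub>1 * real (k n) powr a - c\<^sub>2 * (\<tau> n / 2) powr m * real (k n) powr b)
          \<le> exp (- (\<beta> * (\<rho> - 1) + D) * x n)"
      proof -
        have "c\<^sub>1 * real (k n) powr a \<le> c\<^sub>1 * (\<rho> * x n)"
          using ka assms by (intro mult_left_mono) auto
        moreover have "c\<^sub>2 * (\<gamma> * A * x n) \<le> c\<^sub>2 * ((\<tau> n / 2) powr m * real (k n) powr b)"
          using kb assms by (intro mult_left_mono) auto
        moreover have "(c\<^sub>1 * \<rho> + \<beta> * (\<rho> - 1) + D) * x n \<le> (c\<^sub>2 * \<gamma> * A) * x n"
          using A x_1[of n] by (intro mult_right_mono) auto
        ultimately show ?thesis by (simp add: algebra_simps)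
      qed
      ultimately have "D * exp (c\<^sub>1 * real (k n) powr a - c\<^sub>2 * (\<tau> n / 2) powr m * real (k n) powr b)
          \<le> exp (D * x n) * exp (- (\<beta> * (\<rho> - 1) + D) * x n)"
        using assms by (intro mult_mono) auto
      also have "\<dots> = exp (- \<beta> * (\<rho> - 1) * x n)" by (simp add: algebra_simps flip: exp_add)
      finally have "D * exp (c\<^sub>1 * real (k n) powr a - c\<^sub>2 * (\<tau> n / 2) powr m * real (k n) powr b) * e n
          \<le> exp (- \<beta> * (\<rho> - 1) * x n) * e n"
        by (intro mult_right_mono) (auto simp: e_def)
      also have "\<dots> = e (Suc n)" unfolding e_def x_Suc by (simp add: algebra_simps flip: exp_add)
      finally show ?thesis .
    qed
    \<comment> \<open>A crude geometric bound, from \<open>exp x \<ge> 1 + x\<close>; it yields both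
      the limit of \<open>e\<close> and the summability of the costs.\<close>
    have inv: "exp (- x n) \<le> (1 / \<rho>) ^ n" for n
    proof -
      have "\<rho> ^ n \<le> exp (x n)" using x_ge[of n] exp_ge_add_one_self[of "x n"] by linarith
      then show ?thesis using \<rho> by (simp add: exp_minus field_simps)
    qed
    have lim: "e \<longlonglongrightarrow> 0"
    proof (rule Lim_null_comparison)
      show "(\<lambda>n. exp (\<beta> * N powr a) * (1 / \<rho>) ^ n) \<longlonglongrightarrow> 0"
        using \<rho> by (intro tendsto_mult_right_zero LIMSEQ_power_zero) auto
      have "\<beta> \<ge> 1" unfolding \<beta>_def using assms \<rho> by simp
      have "e n \<le> exp (\<beta> * N powr a) * (1 / \<rho>) ^ n" for n
      proof -
        have "e n \<le> exp (\<beta> * N powr a - x n)"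
          unfolding e_def using mult_right_mono[OF \<open>\<beta> \<ge> 1\<close>, of "x n"] x_1[of n] by (simp add: algebra_simps)
        also have "\<dots> = exp (\<beta> * N powr a) * exp (- x n)" by (simp flip: exp_add)
        also have "\<dots> \<le> exp (\<beta> * N powr a) * (1 / \<rho>) ^ n" using inv by simp
        finally show ?thesis .
      qed
      then show "\<forall>\<^sub>F n in sequentially. norm (e n) \<le> exp (\<beta> * N powr a) * (1 / \<rho>) ^ n"
        by (simp add: e_def)
    qed
    have cost: "(\<Sum>i<n. C\<^sub>1 * exp (c\<^sub>1 * real (k i) powr a) * e i)
        \<le> C\<^sub>0 * exp (c\<^sub>0 * T powr (- (a * m / (b - a))))" for n
    proof -
      have "C\<^sub>1 * exp (c\<^sub>1 * real (k i) powr a) * e i \<le> C\<^sub>1 * exp (\<beta> * N powr a) * (1 / \<rho>) ^ i" for i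
      proof -
        have "exp (c\<^sub>1 * real (k i) powr a) * e i \<le> exp (c\<^sub>1 * (\<rho> * x i)) * e i"
          using ka assms by (intro mult_right_mono) (auto simp: e_def)
        also have "\<dots> = exp (\<beta> * N powr a) * exp (- x i)"
          unfolding e_def \<beta>_def by (simp add: algebra_simps flip: exp_add)
        also have "\<dots> \<le> exp (\<beta> * N powr a) * (1 / \<rho>) ^ i" using inv by simp
        finally show ?thesis using assms by (simp add: mult.assoc)
      qed
      then have "(\<Sum>i<n. C\<^sub>1 * exp (c\<^sub>1 * real (k i) powr a) * e i)
          \<le> (\<Sum>i<n. C\<^sub>1 * exp (\<beta> * N powr a) * (1 / \<rho>) ^ i)"
        by (intro sum_mono)
      also have "\<dots> = C\<^sub>1 * exp (\<beta> * N powr a) * (\<Sum>i<n. (1 / \<rho>) ^ i)"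
        by (simp add: sum_distrib_left)
      also have "\<dots> \<le> C\<^sub>1 * exp (\<beta> * N powr a) * (1 / (1 - 1 / \<rho>))"
      proof (rule mult_left_mono)
        have "(\<Sum>i<n. (1 / \<rho>) ^ i) \<le> (\<Sum>i. (1 / \<rho>) ^ i)"
          using \<rho> by (intro sum_le_suminf summable_geometric) auto
        then show "(\<Sum>i<n. (1 / \<rho>) ^ i) \<le> 1 / (1 - 1 / \<rho>)"
          using \<rho> by (simp add: suminf_geometric)
      qed (use assms in auto)
      also have "\<dots> = C\<^sub>0 * exp (\<beta> * N powr a)"
        unfolding C\<^sub>0_def using \<rho> by (simp add: field_simps)
      also have "\<beta> * N powr a = c\<^sub>0 * T powr (- (a * m / (b - a)))"
        unfolding c\<^sub>0_def Na by (simp add: mult_ac)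
      finally show ?thesis .
    qed
    have e0: "e 0 = 1" by (simp add: e_def x_def)
    show ?thesis
      using \<tau> sums e0 lim step cost by blast
  qed
  ultimately show ?thesis by blast
qed

section \<open>Null-controllability in small time with its cost estimate\<close>

theorem theorem2p7:
  fixes p :: ennreal
    and \<Sigma> :: "real \<Rightarrow> 'y::banach \<times> (real \<Rightarrow> 'u::banach) \<Rightarrow> 'y"
    and P :: "nat \<Rightarrow> 'y \<Rightarrow> 'y"
    and C\<^sub>1 C\<^sub>2 c\<^sub>1 c\<^sub>2 a b m :: real
  assumes "abstract_linear_control_system p \<Sigma>"
    and "\<And>k. is_projection (P k)"
    and "C\<^sub>1 > 0" "C\<^sub>2 > 0" "c\<^sub>1 > 0" "c\<^sub>2 > 0" "a > 0" "b > 0" "m > 0" "a < b"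
    and "\<And>k T y\<^sub>0. \<lbrakk>0 < T; T \<le> 1\<rbrakk> \<Longrightarrow>
      \<exists>u\<in>Lp p Rplus. P k (\<Sigma> T (y\<^sub>0, u)) = 0 \<and>
        Lp_norm p Rplus u \<le> C\<^sub>1 * exp (c\<^sub>1 * real k powr a) * norm y\<^sub>0"
    and "\<And>k T y\<^sub>0. \<lbrakk>0 < T; T \<le> 1; P k y\<^sub>0 = 0\<rbrakk> \<Longrightarrow>
      norm (\<Sigma> T (y\<^sub>0, \<lambda>_. 0)) \<le> C\<^sub>2 * exp (- c\<^sub>2 * T powr m * real k powr b) * norm y\<^sub>0"
  shows "small_time_null_controllable p \<Sigma> \<and>
    (let \<sigma> = a * m / (b - a) in
      \<exists>C\<^sub>0>0. \<exists>c\<^sub>0>0. \<forall>T y\<^sub>0. 0 < T \<and> T \<le> 1 \<longrightarrow>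
        (\<exists>u\<in>Lp p (lebesgue_on {0<..<T}).
          \<Sigma> T (y\<^sub>0, zero_extension {0<..<T} u) = 0 \<and>
          Lp_norm p (lebesgue_on {0<..<T}) u \<le> C\<^sub>0 * exp (c\<^sub>0 * T powr (- \<sigma>)) * norm y\<^sub>0))"
proof -
  interpret abstract_linear_control_system p \<Sigma> by fact
  note pos = assms(3-10) and control = assms(11) and dissipation = assms(12)
  note zero = Lp_0[OF exponent, where ?'u='u]
  obtain K where K: "K > 0" "\<And>t y u. 0 \<le> t \<Longrightarrow> t \<le> 1 \<Longrightarrow> u \<in> Lp p Rplus
      \<Longrightarrow> norm (\<Sigma> t (y, u)) \<le> K * (norm y + Lp_norm p Rplus u)"
    using uniform_bound by blast
  \<comment> \<open>The controlled half multiplies the state by at most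
    \<open>K * (1 + C\<^sub>1)\<close> times the exponential cost; the free half contributes
    \<open>C\<^sub>2\<close> and the decay.\<close>
  define D where "D = C\<^sub>2 * K * (1 + C\<^sub>1)"
  have D: "D > 0" unfolding D_def using pos K(1) by (simp add: add_pos_pos)
  have step: "\<exists>v\<in>Lp p Rplus. Lp_norm p Rplus v \<le> C\<^sub>1 * exp (c\<^sub>1 * real k powr a) * norm y \<and>
      norm (\<Sigma> \<tau> (y, v)) \<le> D * exp (c\<^sub>1 * real k powr a - c\<^sub>2 * (\<tau> / 2) powr m * real k powr b) * norm y"
    if \<tau>: "0 < \<tau>" "\<tau> \<le> 1" for \<tau> k y
  proof -
    let ?h = "\<tau> / 2" and ?E = "exp (c\<^sub>1 * real k powr a)" and ?F = "exp (- c\<^sub>2 * (\<tau> / 2) powr m * real k powr b)"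
    have h: "0 < ?h" "?h \<le> 1" using \<tau> by auto
    obtain u where u: "u \<in> Lp p Rplus" "P k (\<Sigma> ?h (y, u)) = 0"
      "Lp_norm p Rplus u \<le> C\<^sub>1 * ?E * norm y"
      using control[OF h] by blast
    let ?v = "concatenation ?h u (\<lambda>_. 0)"
    have v: "?v \<in> Lp p Rplus" "Lp_norm p Rplus ?v \<le> C\<^sub>1 * ?E * norm y"
      using concatenation_Lp[OF exponent _ u(1) zero(1), of ?h] h u(3) zero(2) by auto
    have "norm (\<Sigma> ?h (y, u)) \<le> K * (norm y + Lp_norm p Rplus u)"
      using K(2)[of ?h u y] h u by simp
    also have "\<dots> \<le> K * (?E * norm y + C\<^sub>1 * ?E * norm y)"
    proof (intro mult_left_mono add_mono)
      \<comment> \<open>The contribution of the initial state is enlarged by \<open>?E\<close> so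
        that both terms share this factor.\<close>
      have "1 \<le> ?E" using pos by simp
      then show "norm y \<le> ?E * norm y" using mult_right_mono[of 1 ?E "norm y"] by simp
    qed (use K(1) u(3) in auto)
    finally have half: "norm (\<Sigma> ?h (y, u)) \<le> K * (1 + C\<^sub>1) * ?E * norm y"
      by (simp add: algebra_simps)
    have "\<Sigma> \<tau> (y, ?v) = \<Sigma> ?h (\<Sigma> ?h (y, u), \<lambda>_. 0)"
      using concat[of ?h ?h u "\<lambda>_. 0" y] h u zero by simp
    also have "norm \<dots> \<le> C\<^sub>2 * ?F * norm (\<Sigma> ?h (y, u))"
      using dissipation[OF h u(2)] .
    also have "\<dots> \<le> C\<^sub>2 * ?F * (K * (1 + C\<^sub>1) * ?E * norm y)"
      using half pos by (intro mult_left_mono) auto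
    also have "\<dots> = D * (?E * ?F) * norm y" by (simp add: D_def mult_ac)
    also have "?E * ?F = exp (c\<^sub>1 * real k powr a - c\<^sub>2 * (\<tau> / 2) powr m * real k powr b)"
      by (simp flip: exp_add)
    finally show ?thesis using v by (intro bexI[of _ ?v] conjI)
  qed
  obtain C\<^sub>0 c\<^sub>0 where C: "C\<^sub>0 > 0" "c\<^sub>0 > 0" and parameters:
    "\<forall>T. 0 < T \<and> T \<le> 1 \<longrightarrow> (\<exists>(k :: nat \<Rightarrow> nat) (\<tau> :: nat \<Rightarrow> real) (e :: nat \<Rightarrow> real).
      (\<forall>n. 0 < \<tau> n \<and> \<tau> n \<le> 1) \<and> \<tau> sums T \<and> e 0 = 1 \<and> e \<longlonglongrightarrow> 0 \<and>
      (\<forall>n. D * exp (c\<^sub>1 * real (k n) powr a - c\<^sub>2 * (\<tau> n / 2) powr m * real (k n) powr b) * e n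
        \<le> e (Suc n)) \<and>
      (\<forall>n. (\<Sum>i<n. C\<^sub>1 * exp (c\<^sub>1 * real (k i) powr a) * e i)
        \<le> C\<^sub>0 * exp (c\<^sub>0 * T powr (- (a * m / (b - a))))))"
    using iteration_parameters[OF assms(3) D assms(5-7,9,10)] by blast
  have main: "\<exists>u\<in>Lp p Rplus. \<Sigma> T (y, u) = 0 \<and>
      Lp_norm p Rplus u \<le> C\<^sub>0 * exp (c\<^sub>0 * T powr (- (a * m / (b - a)))) * norm y"
    if T: "0 < T" "T \<le> 1" for T y
  proof -
    obtain k :: "nat \<Rightarrow> nat" and \<tau> e where *: "\<And>n. 0 < \<tau> n \<and> \<tau> n \<le> 1" "\<tau> sums T" "e 0 = 1" "e \<longlonglongrightarrow> 0"
      "\<And>n. D * exp (c\<^sub>1 * real (k n) powr a - c\<^sub>2 * (\<tau> n / 2) powr m * real (k n) powr b) * e n \<le> e (Suc n)"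
      "\<And>n. (\<Sum>i<n. C\<^sub>1 * exp (c\<^sub>1 * real (k i) powr a) * e i)
        \<le> C\<^sub>0 * exp (c\<^sub>0 * T powr (- (a * m / (b - a))))"
      using parameters[rule_format, OF conjI, OF T] by blast
    show ?thesis
    proof (rule null_control_iteration[OF _ *(2) _ _ _ *(3) *(5) *(4) *(6)])
      show "\<exists>v\<in>Lp p Rplus. Lp_norm p Rplus v \<le> C\<^sub>1 * exp (c\<^sub>1 * real (k n) powr a) * norm y \<and>
          norm (\<Sigma> (\<tau> n) (y, v))
            \<le> D * exp (c\<^sub>1 * real (k n) powr a - c\<^sub>2 * (\<tau> n / 2) powr m * real (k n) powr b) * norm y" for n y
        using *(1)[of n] by (intro step) auto
    qed (use *(1) pos(1) D in \<open>auto intro: less_imp_le\<close>)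
  qed
  \<comment> \<open>Passing from the half-line to (0,T) keeps the final state and does not increase
    the norm.\<close>
  have restrict: "u \<in> Lp p (lebesgue_on {0<..<T}) \<and>
      Lp_norm p (lebesgue_on {0<..<T}) u \<le> Lp_norm p Rplus u \<and>
      \<Sigma> T (y, zero_extension {0<..<T} u) = \<Sigma> T (y, u)"
    if "0 < T" "u \<in> Lp p Rplus" for T y u
    using Lp_restrict(1,2)[OF exponent that(2), of "{0<..<T}"] zero_extension_eq[OF that]
    by (simp add: subset_eq)
  have "small_time_null_controllable p \<Sigma>"
    unfolding small_time_null_controllable_def
  proof (intro allI impI)
    fix T :: real and y assume T: "T > 0"
    \<comment> \<open>For \<open>T\<close> above 1 the state is steered to 0 by time 1 and stays
      there under zero control, by linearity.\<close>
    let ?S = "min T 1"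
    obtain u where u: "u \<in> Lp p Rplus" "\<Sigma> ?S (y, u) = 0"
      using main[of ?S y] T by auto
    let ?v = "concatenation ?S u (\<lambda>_. 0)"
    have v: "?v \<in> Lp p Rplus"
      using concatenation_Lp(1)[OF exponent _ u(1) zero(1)] T by simp
    have "\<Sigma> (T - ?S) (0, \<lambda>_. 0) = 0"
      using scale[OF _ zero(1), of "T - ?S" 0 0] by simp
    then have "\<Sigma> T (y, ?v) = 0"
      using concat[of "T - ?S" ?S u "\<lambda>_. 0" y] T u zero by simp
    then show "\<exists>u\<in>Lp p (lebesgue_on {0<..<T}). \<Sigma> T (y, zero_extension {0<..<T} u) = 0"
      using restrict[OF T v, of y] by (intro bexI[of _ ?v]) auto
  qed
  moreover have "\<exists>u\<in>Lp p (lebesgue_on {0<..<T}). \<Sigma> T (y, zero_extension {0<..<T} u) = 0 \<and>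
      Lp_norm p (lebesgue_on {0<..<T}) u \<le> C\<^sub>0 * exp (c\<^sub>0 * T powr (- (a * m / (b - a)))) * norm y"
    if T: "0 < T" "T \<le> 1" for T y
  proof -
    obtain u where u: "u \<in> Lp p Rplus" "\<Sigma> T (y, u) = 0"
      "Lp_norm p Rplus u \<le> C\<^sub>0 * exp (c\<^sub>0 * T powr (- (a * m / (b - a)))) * norm y"
      using main[OF T] by blast
    show ?thesis
      using restrict[OF T(1) u(1), of y] u(2,3) by (intro bexI[of _ u]) auto
  qed
  ultimately show ?thesis using C unfolding Let_def by blast
qed

end
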